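(* Let $0<2k\le n\le N$, let $A\in\mathbb{R}^{n\times N}$ be such that any $2k$ of its columns are linearly independent, and let $b\in\mathbb{R}^n$. Suppose that the constant stepsize $\alpha>0$ of the IHT algorithm satisfies $$\alpha<\frac{1}{1+U_{2k}},$$ where $U_{2k}$ is the upper RIP constant of $A$ of order $2k$. Then the IHT iterates $\{x^m\}$ converge to an $\alpha$-stable point $\bar x$ of IHT (that is, an $\alpha$-stable point on some index set $\Gamma$ with $|\Gamma|=k$).
   Context: $\|\cdot\|$ is the Euclidean norm and $\|y\|_0$ the number of nonzero entries of $y$. The upper RIP constant of order $s$ is $U_s=\max_{1\le\|y\|_0\le s}\frac{\|Ay\|^2}{\|y\|^2}-1$. Hard thresholding: $\mathcal{H}_k(x)$ keeps the $k$ entries of $x$ of largest magnitude and sets the others to zero, ties being broken by some selection rule (random or according to a predefined ordering); so $\mathcal{H}_k(x)\in\arg\min_{\|z\|_0\le k}\|z-x\|$. IHT with stepsize $\alpha$: $x^0=0$ and $x^{m+1}=\mathcal{H}_k\{x^m-\alpha A^T(Ax^m-b)\}$ for $m\ge0$. Stable points: given $\underline{\alpha}>0$ and an index set $\Gamma\subseteq\{1,\dots,N\}$ with $|\Gamma|=k$, $\bar x\in\mathbb{R}^N$ is an $\underline{\alpha}$-stable point on $\Gamma$ if $\mathrm{supp}(\bar x)\subseteq\Gamma$, $\{A^T(b-A\bar x)\}_\Gamma=0$, and $\min_{i\in\Gamma}|\bar x_i|\ge\underline{\alpha}\max_{j\in\Gamma^C}|\{A^T(b-A\bar x)\}_j|$,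 where subscript $\Gamma$ denotes restriction of a vector to the entries in $\Gamma$ and $\Gamma^C=\{1,\dots,N\}\setminus\Gamma$. *)

theory Defs
  imports "HOL-Analysis.Analysis"
begin

definition supp :: "real ^ 'N \<Rightarrow> 'N set" where
  "supp y = {i. y $ i \<noteq> 0}"

definition norm0 :: "real ^ 'N \<Rightarrow> nat" where
  "norm0 y = card (supp y)"

text \<open>
  The columns are treated as an indexed family: repeated columns count as dependent,
  hence the injectivity requirement next to linear independence of the image set.
\<close>
definition columns_independent :: "nat \<Rightarrow> real ^ 'N ^ 'n \<Rightarrow> bool" where
  "columns_independent s A \<longleftrightarrow>
     (\<forall>S. card S = s \<longrightarrow> inj_on (\<lambda>j. column j A) S \<and> independent ((\<lambda>j. column j A) ` S))"

text \<open>
  The supremum is a maximum for \<open>1 \<le> s\<close>; see \<open>upper_RIP_attained\<close> below.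
\<close>
definition upper_RIP :: "real ^ 'N ^ 'n \<Rightarrow> nat \<Rightarrow> real" where
  "upper_RIP A s =
     (SUP y \<in> {y. 1 \<le> norm0 y \<and> norm0 y \<le> s}. (norm (A *v y))\<^sup>2 / (norm y)\<^sup>2) - 1"

text \<open>
  Hard thresholding as a relation between input \<open>x\<close> and output \<open>z\<close>, so that every way of
  breaking ties (including random or iteration-dependent ones) is covered. \<open>S\<close> is the set of
  indices of the \<open>k\<close> entries that are kept.
\<close>
definition hard_threshold :: "nat \<Rightarrow> real ^ 'N \<Rightarrow> real ^ 'N \<Rightarrow> bool" where
  "hard_threshold k x z \<longleftrightarrow>
     (\<exists>S. card S = k \<and> (\<forall>i\<in>S. \<forall>j\<in>-S. \<bar>x $ j\<bar> \<le> \<bar>x $ i\<bar>) \<and>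
          z = (\<chi> i. if i \<in> S then x $ i else 0))"

definition iht_iterates ::
    "real ^ 'N ^ 'n \<Rightarrow> real ^ 'n \<Rightarrow> nat \<Rightarrow> real \<Rightarrow> (nat \<Rightarrow> real ^ 'N) \<Rightarrow> bool" where
  "iht_iterates A b k \<alpha> x \<longleftrightarrow>
     x 0 = 0 \<and>
     (\<forall>m. hard_threshold k (x m - \<alpha> *\<^sub>R (transpose A *v (A *v x m - b))) (x (Suc m)))"

text \<open>
  \<open>Min\<close> and \<open>Max\<close> are meaningful only on nonempty sets, that is, for \<open>0 < card \<Gamma> < CARD('N)\<close>.
\<close>
definition stable_point_on ::
    "real ^ 'N ^ 'n \<Rightarrow> real ^ 'n \<Rightarrow> real \<Rightarrow> 'N set \<Rightarrow> real ^ 'N \<Rightarrow> bool" where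
  "stable_point_on A b \<alpha> \<Gamma> x \<longleftrightarrow>
     supp x \<subseteq> \<Gamma> \<and>
     (\<forall>i\<in>\<Gamma>. (transpose A *v (b - A *v x)) $ i = 0) \<and>
     Min ((\<lambda>i. \<bar>x $ i\<bar>) ` \<Gamma>) \<ge> \<alpha> * Max ((\<lambda>j. \<bar>(transpose A *v (b - A *v x)) $ j\<bar>) ` (-\<Gamma>))"

lemma norm0_eq_0_iff: "norm0 y = 0 \<longleftrightarrow> y = 0"
  by (auto simp: norm0_def supp_def vec_eq_iff)

lemma closed_sparse: "closed {y :: real ^ 'N. norm0 y \<le> s}"
proof -
  have "{y :: real ^ 'N. norm0 y \<le> s} = (\<Union>S\<in>{S. card S \<le> s}. \<Inter>i\<in>-S. {y. y $ i = 0})"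
  proof (intro set_eqI iffI)
    fix y :: "real ^ 'N"
    assume "y \<in> {y. norm0 y \<le> s}"
    then show "y \<in> (\<Union>S\<in>{S. card S \<le> s}. \<Inter>i\<in>-S. {y. y $ i = 0})"
      by (intro UN_I[of "supp y"]) (auto simp: norm0_def supp_def)
  next
    fix y :: "real ^ 'N"
    assume "y \<in> (\<Union>S\<in>{S. card S \<le> s}. \<Inter>i\<in>-S. {y. y $ i = 0})"
    then obtain S where S: "card S \<le> s" "\<And>i. i \<notin> S \<Longrightarrow> y $ i = 0" by auto
    have "card (supp y) \<le> card S"
      by (rule card_mono) (use S in \<open>auto simp: supp_def\<close>)
    with S show "y \<in> {y. norm0 y \<le> s}" by (simp add: norm0_def)
  qed
  moreover have "closed (\<Union>S\<in>{S::'N set. card S \<le> s}. \<Inter>i\<in>-S. {y :: real ^ 'N. y $ i = 0})"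
    by (intro closed_UN finite closed_INT ballI closed_Collect_eq continuous_intros)
  ultimately show ?thesis by simp
qed

lemma norm0_scaleR: "c \<noteq> 0 \<Longrightarrow> norm0 (c *\<^sub>R y) = norm0 y"
  by (simp add: norm0_def supp_def)

lemma upper_RIP_attained:
  fixes A :: "real ^ 'N ^ 'n"
  assumes "1 \<le> s"
  shows "\<exists>y. 1 \<le> norm0 y \<and> norm0 y \<le> s \<and>
             upper_RIP A s = (norm (A *v y))\<^sup>2 / (norm y)\<^sup>2 - 1 \<and>
             (\<forall>z. 1 \<le> norm0 z \<and> norm0 z \<le> s \<longrightarrow>
                  (norm (A *v z))\<^sup>2 / (norm z)\<^sup>2 \<le> (norm (A *v y))\<^sup>2 / (norm y)\<^sup>2)"
proof -
  let ?q = "\<lambda>y. (norm (A *v y))\<^sup>2 / (norm y)\<^sup>2"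
  let ?K = "sphere 0 1 \<inter> {y :: real ^ 'N. norm0 y \<le> s}"
  have "compact ?K" by (intro compact_Int_closed compact_sphere closed_sparse)
  moreover have "?K \<noteq> {}"
  proof -
    have "supp (axis i 1 :: real ^ 'N) = {i}" for i by (auto simp: supp_def axis_def)
    then have "axis i 1 \<in> ?K" for i using assms by (simp add: norm0_def norm_axis_1)
    then show ?thesis by blast
  qed
  moreover have "continuous_on ?K (\<lambda>y. (norm (A *v y))\<^sup>2)"
    by (intro continuous_intros linear_continuous_on matrix_vector_mul_bounded_linear)
  ultimately obtain y where y: "y \<in> ?K"
    and max: "\<And>z. z \<in> ?K \<Longrightarrow> (norm (A *v z))\<^sup>2 \<le> (norm (A *v y))\<^sup>2"
    using continuous_attains_sup by meson
  have y0: "1 \<le> norm0 y" "norm0 y \<le> s"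
    using y norm0_eq_0_iff[of y] by (auto simp: Suc_le_eq)
  have le: "?q z \<le> ?q y" if z: "1 \<le> norm0 z" "norm0 z \<le> s" for z
  proof -
    have nz: "z \<noteq> 0" using z norm0_eq_0_iff[of z] by auto
    then have "(1 / norm z) *\<^sub>R z \<in> ?K" using z by (simp add: norm0_scaleR)
    from max[OF this] have "?q z \<le> (norm (A *v y))\<^sup>2"
      by (simp add: matrix_vector_mult_scaleR power_divide)
    then show ?thesis using y by simp
  qed
  have "(SUP z \<in> {z. 1 \<le> norm0 z \<and> norm0 z \<le> s}. ?q z) = ?q y"
    by (rule cSup_eq_maximum) (use y0 le in auto)
  then show ?thesis using y0 le by (auto simp: upper_RIP_def)
qed

end

theory Submission
  imports Defs
begin

text \<open>
  Since \<open>\<alpha> (1 + U) < 1\<close> for the upper RIP constant \<open>U\<close> of order \<open>2k\<close>, each step decreases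
  \<open>\<parallel>Ax - b\<parallel>\<^sup>2\<close> by at least a fixed multiple of \<open>\<parallel>x\<^sup>m\<^sup>+\<^sup>1 - x\<^sup>m\<parallel>\<^sup>2\<close>, so the steps tend to zero.
  On the support \<open>\<Gamma>\<close> selected in a step, the gradient at the old iterate is a multiple of
  the step; hence the new iterate is almost the least squares solution on \<open>\<Gamma>\<close>, which is unique
  because the columns in \<open>\<Gamma>\<close> are independent. So the iterates approach the finite set of these
  solutions, and a sequence with vanishing steps which approaches a finite set converges.
  Some \<open>\<Gamma>\<close> is selected infinitely often, and passing to the limit in the selection rule along
  that subsequence shows that the limit is stable on \<open>\<Gamma>\<close>.
\<close>

declare transpose_matrix_vector [simp del]

section \<open>Sequences approaching a finite set\<close>

text \<open>Distinct points of \<open>P\<close> are at least some \<open>d > 0\<close> apart. Once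
  steps and distances to \<open>P\<close> are below \<open>d / 3\<close>, the nearby point cannot
  change: by the triangle inequality two points of \<open>P\<close> would be closer than
  \<open>d\<close>.\<close>

lemma convergent_if_near_finite_set:
  fixes x :: "nat \<Rightarrow> 'a::metric_space"
  assumes P: "finite P"
    and step: "(\<lambda>n. dist (x (Suc n)) (x n)) \<longlonglongrightarrow> 0"
    and near: "\<And>e. e > 0 \<Longrightarrow> eventually (\<lambda>n. \<exists>p\<in>P. dist (x n) p < e) sequentially"
  shows "\<exists>p\<in>P. x \<longlonglongrightarrow> p"
proof -
  define D where "D = (\<lambda>(p, q). dist p q) ` {(p, q) \<in> P \<times> P. p \<noteq> q}"
  \<comment> \<open>The inserted 1 keeps \<open>Min\<close> meaningful when \<open>P\<close> has at
    most one point and \<open>D\<close> is empty.\<close>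
  define d where "d = Min (insert 1 D)"
  have fin: "finite D"
    unfolding D_def by (rule finite_imageI, rule finite_subset[of _ "P \<times> P"]) (use P in auto)
  have "d > 0" unfolding d_def using fin by (auto simp: D_def)
  have sep: "p = q" if "p \<in> P" "q \<in> P" "dist p q < d" for p q
  proof (rule ccontr)
    assume "p \<noteq> q"
    then have "dist p q \<in> D" using that unfolding D_def by (force intro: image_eqI[of _ _ "(p, q)"])
    then have "d \<le> dist p q" unfolding d_def using fin by simp
    with that show False by simp
  qed
  have "eventually (\<lambda>n. dist (x (Suc n)) (x n) < d / 3) sequentially"
    using order_tendstoD(2)[OF step, of "d / 3"] \<open>d > 0\<close> by simp
  moreover have "eventually (\<lambda>n. \<exists>p\<in>P. dist (x n) p < d / 3) sequentially"
    using near[of "d / 3"] \<open>d > 0\<close> by simp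
  ultimately have "eventually (\<lambda>n. dist (x (Suc n)) (x n) < d / 3 \<and>
      (\<exists>p\<in>P. dist (x n) p < d / 3)) sequentially"
    by (rule eventually_conj)
  then obtain N where N: "\<And>n. n \<ge> N \<Longrightarrow> dist (x (Suc n)) (x n) < d / 3"
      "\<And>n. n \<ge> N \<Longrightarrow> \<exists>p\<in>P. dist (x n) p < d / 3"
    unfolding eventually_sequentially by blast
  obtain p where p: "p \<in> P" "dist (x N) p < d / 3" using N(2) by blast
  have stay: "dist (x n) p < d / 3" if "n \<ge> N" for n
    using that
  proof (induction n rule: dec_induct)
    case base
    then show ?case using p by simp
  next
    case (step n)
    obtain q where q: "q \<in> P" "dist (x (Suc n)) q < d / 3" using N(2)[of "Suc n"] step by auto
    have "dist p q \<le> dist (x n) p + dist (x (Suc n)) (x n) + dist (x (Suc n)) q"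
      by (smt (verit) dist_commute dist_triangle)
    then have "p = q" using sep[of p q] p q N(1)[of n] step by linarith
    then show ?case using q by simp
  qed
  have "x \<longlonglongrightarrow> p"
  proof (rule tendstoI)
    fix e :: real assume "e > 0"
    \<comment> \<open>The bound \<open>d / 3\<close> forces the nearby point to be \<open>p\<close>;
      the bound \<open>e\<close> then gives convergence.\<close>
    then have "eventually (\<lambda>n. \<exists>q\<in>P. dist (x n) q < min e (d / 3)) sequentially"
      using near[of "min e (d / 3)"] \<open>d > 0\<close> by simp
    moreover have "eventually (\<lambda>n. n \<ge> N) sequentially" by (rule eventually_ge_at_top)
    ultimately show "eventually (\<lambda>n. dist (x n) p < e) sequentially"
    proof eventually_elim
      case (elim n)
      then obtain q where q: "q \<in> P" "dist (x n) q < e" "dist (x n) q < d / 3" by auto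
      have "dist p q \<le> dist (x n) p + dist (x n) q" by (metis dist_commute dist_triangle)
      then have "p = q" using sep[of p q] p q stay[of n] elim \<open>d > 0\<close> by linarith
      then show ?case using q by simp
    qed
  qed
  then show ?thesis using p by blast
qed

section \<open>Restriction, sparsity and independent columns\<close>

definition restrict_vec :: "'N set \<Rightarrow> real ^ 'N \<Rightarrow> real ^ 'N" where
  "restrict_vec S y = (\<chi> i. if i \<in> S then y $ i else 0)"

lemma restrict_vec_nth [simp]: "restrict_vec S y $ i = (if i \<in> S then y $ i else 0)"
  by (simp add: restrict_vec_def)

lemma norm_restrict_vec_le: "norm (restrict_vec S y) \<le> norm y"
  by (rule norm_le_componentwise_cart) simp

lemma linear_restrict_vec: "linear (restrict_vec S)"
  by (rule linearI) (auto simp: vec_eq_iff)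

lemma norm0_diff_le: "norm0 (y - z) \<le> norm0 y + norm0 z"
proof -
  have "supp (y - z) \<subseteq> supp y \<union> supp z" by (auto simp: supp_def)
  then have "card (supp (y - z)) \<le> card (supp y \<union> supp z)" by (simp add: card_mono)
  also have "\<dots> \<le> card (supp y) + card (supp z)" by (rule card_Un_le)
  finally show ?thesis by (simp add: norm0_def)
qed

text \<open>\<open>columns_independent\<close> speaks only of sets of exactly \<open>s\<close>
  columns, so the support is first enlarged to such a set; \<open>A *v y = 0\<close> is then a
  linear relation among independent columns.\<close>

lemma columns_independent_null:
  fixes A :: "real ^ 'N ^ 'n"
  assumes ind: "columns_independent s A" and s: "s \<le> CARD('N)"
    and y: "norm0 y \<le> s" "A *v y = 0"
  shows "y = 0"
proof -
  obtain T where T: "supp y \<subseteq> T" "card T = s"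
    using exists_subset_between[of "supp y" s UNIV] y s by (auto simp: norm0_def)
  let ?c = "\<lambda>j. column j A"
  have inj: "inj_on ?c T" and indep: "independent (?c ` T)"
    using ind T by (auto simp: columns_independent_def)
  have "0 = (\<Sum>j\<in>UNIV. y $ j *\<^sub>R ?c j)"
    using y by (simp add: matrix_mult_sum scalar_mult_eq_scaleR)
  also have "\<dots> = (\<Sum>j\<in>T. y $ j *\<^sub>R ?c j)"
    using T by (intro sum.mono_neutral_right) (auto simp: supp_def)
  \<comment> \<open>Independence concerns a set of vectors, so the sum is reindexed by the columns
    themselves, using injectivity.\<close>
  also have "\<dots> = (\<Sum>v\<in>?c ` T. y $ (the_inv_into T ?c v) *\<^sub>R v)"
    by (simp add: sum.reindex[OF inj] the_inv_into_f_f[OF inj])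
  finally have sum0: "(\<Sum>v\<in>?c ` T. y $ (the_inv_into T ?c v) *\<^sub>R v) = 0" by simp
  have "y $ j = 0" if "j \<in> T" for j
    using independentD[OF indep _ _ sum0, of "?c j"] that by (simp add: the_inv_into_f_f[OF inj])
  then show ?thesis using T by (auto simp: vec_eq_iff supp_def)
qed

section \<open>Descent in one step\<close>

lemma upper_RIP_bound:
  fixes A :: "real ^ 'N ^ 'n"
  assumes "1 \<le> s" "norm0 y \<le> s"
  shows "(norm (A *v y))\<^sup>2 \<le> (1 + upper_RIP A s) * (norm y)\<^sup>2"
proof (cases "y = 0")
  case False
  then have "1 \<le> norm0 y" using norm0_eq_0_iff[of y] by auto
  then have "(norm (A *v y))\<^sup>2 / (norm y)\<^sup>2 \<le> 1 + upper_RIP A s"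
    using upper_RIP_attained[of s A] assms by auto
  then show ?thesis using False by (simp add: divide_le_eq)
qed simp

text \<open>An exchange argument: entries of \<open>u\<close> lost on \<open>supp y - S\<close> are
  matched injectively with entries on \<open>S - supp y\<close>, which are at least as large. So
  \<open>u\<close> has no more mass off \<open>S\<close> than off \<open>supp y\<close>, where
  \<open>y - u\<close> equals \<open>- u\<close>.\<close>

lemma hard_threshold_nearest:
  fixes u :: "real ^ 'N"
  assumes S: "card S = k" "\<And>i j. i \<in> S \<Longrightarrow> j \<notin> S \<Longrightarrow> \<bar>u $ j\<bar> \<le> \<bar>u $ i\<bar>"
    and y: "norm0 y \<le> k"
  shows "(norm (restrict_vec S u - u))\<^sup>2 \<le> (norm (y - u))\<^sup>2"
proof -
  let ?T = "supp y"
  have nsq: "(norm v)\<^sup>2 = (\<Sum>i\<in>UNIV. (v $ i)\<^sup>2)" for v :: "real ^ 'N"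
    by (simp add: norm_vec_def L2_set_def sum_nonneg)
  have "card (?T - S) \<le> card (S - ?T)"
    using y S(1) card_Int_Diff[of ?T S] card_Int_Diff[of S ?T]
    by (simp add: norm0_def Int_commute)
  then obtain f where f: "f ` (?T - S) \<subseteq> S - ?T" "inj_on f (?T - S)"
    using card_le_inj[of "?T - S" "S - ?T"] by auto
  have "(\<Sum>j\<in>?T - S. (u $ j)\<^sup>2) \<le> (\<Sum>j\<in>?T - S. (u $ f j)\<^sup>2)"
    using f S(2) by (intro sum_mono) (auto simp: abs_le_square_iff[symmetric])
  also have "\<dots> = (\<Sum>i\<in>f ` (?T - S). (u $ i)\<^sup>2)" by (simp add: sum.reindex[OF f(2)])
  also have "\<dots> \<le> (\<Sum>i\<in>S - ?T. (u $ i)\<^sup>2)" by (intro sum_mono2 f(1)) auto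
  finally have swap: "(\<Sum>j\<in>?T - S. (u $ j)\<^sup>2) \<le> (\<Sum>i\<in>S - ?T. (u $ i)\<^sup>2)" .
  have split: "(\<Sum>i\<in>-X. (u $ i)\<^sup>2) = (\<Sum>i\<in>Y - X. (u $ i)\<^sup>2) + (\<Sum>i\<in>-(X \<union> Y). (u $ i)\<^sup>2)" for X Y
    by (subst sum.union_disjoint[symmetric]) (auto intro: sum.cong)
  have "(norm (restrict_vec S u - u))\<^sup>2 = (\<Sum>i\<in>-S. (u $ i)\<^sup>2)"
    unfolding nsq by (rule sum.mono_neutral_cong_right) auto
  also have "\<dots> \<le> (\<Sum>i\<in>-?T. (u $ i)\<^sup>2)"
    using swap split[of S ?T] split[of ?T S] by (simp add: Un_commute)
  also have "\<dots> = (\<Sum>i\<in>-?T. ((y - u) $ i)\<^sup>2)"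
    by (rule sum.cong) (auto simp: supp_def)
  also have "\<dots> \<le> (norm (y - u))\<^sup>2"
    unfolding nsq by (intro sum_mono2) auto
  finally show ?thesis .
qed

text \<open>With step \<open>d\<close> and residual \<open>r\<close>, expanding \<open>near\<close>
  bounds the cross term \<open>(A *v d) \<bullet> r\<close> from above. The exact quadratic
  expansion of the new residual contains this term, and \<open>L\<close> controls its remaining
  term.\<close>

lemma iht_step_decrease:
  fixes A :: "real ^ 'N ^ 'n"
  assumes a: "\<alpha> > 0"
    and near: "(norm (z - (y - \<alpha> *\<^sub>R (transpose A *v (A *v y - b)))))\<^sup>2
      \<le> (norm (y - (y - \<alpha> *\<^sub>R (transpose A *v (A *v y - b)))))\<^sup>2"
    and L: "(norm (A *v (z - y)))\<^sup>2 \<le> L * (norm (z - y))\<^sup>2"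
  shows "(1 - \<alpha> * L) * (norm (z - y))\<^sup>2 \<le> \<alpha> * ((norm (A *v y - b))\<^sup>2 - (norm (A *v z - b))\<^sup>2)"
proof -
  define r where "r = A *v y - b"
  define d where "d = z - y"
  have adj: "(A *v d) \<bullet> r = d \<bullet> (transpose A *v r)"
    by (metis dot_lmul_matrix inner_commute transpose_matrix_vector)
  have eqs: "z - (y - \<alpha> *\<^sub>R (transpose A *v r)) = d + \<alpha> *\<^sub>R (transpose A *v r)"
    "y - (y - \<alpha> *\<^sub>R (transpose A *v r)) = \<alpha> *\<^sub>R (transpose A *v r)"
    by (auto simp: d_def)
  have 1: "(norm d)\<^sup>2 + 2 * \<alpha> * ((A *v d) \<bullet> r) \<le> 0"
  proof -
    have "(norm (d + \<alpha> *\<^sub>R v))\<^sup>2 = (norm d)\<^sup>2 + 2 * \<alpha> * (d \<bullet> v) + (norm (\<alpha> *\<^sub>R v))\<^sup>2" for v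
      unfolding power2_norm_eq_inner by (simp add: inner_simps inner_commute algebra_simps)
    then show ?thesis using near unfolding r_def[symmetric] eqs adj by simp
  qed
  have "A *v z - b = r + A *v d"
    by (simp add: r_def d_def matrix_vector_mult_diff_distrib)
  then have 2: "(norm (A *v z - b))\<^sup>2 = (norm r)\<^sup>2 + 2 * ((A *v d) \<bullet> r) + (norm (A *v d))\<^sup>2"
    by (simp add: power2_norm_eq_inner inner_simps inner_commute algebra_simps)
  have "\<alpha> * (norm (A *v d))\<^sup>2 \<le> \<alpha> * (L * (norm d)\<^sup>2)"
    using L a by (simp add: d_def)
  with 1 2 show ?thesis
    unfolding r_def[symmetric] d_def[symmetric] by (simp add: algebra_simps)
qed

section \<open>Least squares on an index set and stable limits\<close>

text \<open>
  The witness is the least squares solution on \<open>\<Gamma>\<close>. The map \<open>G\<close> in the proof extends the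
  invertible normal-equation operator on the coordinate subspace of \<open>\<Gamma>\<close> by the identity on
  the complementary coordinates.
\<close>
lemma least_squares_error_bound:
  fixes A :: "real ^ 'N ^ 'n" and b :: "real ^ 'n"
  assumes null: "\<And>y. supp y \<subseteq> \<Gamma> \<Longrightarrow> A *v y = 0 \<Longrightarrow> y = 0"
  obtains p B where "B > 0"
    "\<And>y. supp y \<subseteq> \<Gamma> \<Longrightarrow> B * norm (y - p) \<le> norm (restrict_vec \<Gamma> (transpose A *v (A *v y - b)))"
proof -
  define G where "G = (\<lambda>y. restrict_vec \<Gamma> (transpose A *v (A *v y)) + restrict_vec (-\<Gamma>) y)"
  have lin: "linear G"
    unfolding G_def
    by (intro linear_compose_add linear_restrict_vec
        linear_compose[OF _ linear_restrict_vec, unfolded o_def]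
        linear_compose[OF _ matrix_vector_mul_linear, unfolded o_def] matrix_vector_mul_linear)
  have "y = 0" if G0: "G y = 0" for y
  proof -
    have c: "G y $ i = 0" for i using G0 by simp
    have "y $ i = 0" if "i \<notin> \<Gamma>" for i
      using c[of i] that by (simp add: G_def)
    then have s: "supp y \<subseteq> \<Gamma>" by (auto simp: supp_def)
    have z: "(transpose A *v (A *v y)) $ i = 0" if "i \<in> \<Gamma>" for i
      using c[of i] that by (simp add: G_def)
    \<comment> \<open>In the inner product on the right, \<open>y\<close> vanishes off \<Gamma> and
      the other factor vanishes on \<Gamma>.\<close>
    have "(A *v y) \<bullet> (A *v y) = y \<bullet> (transpose A *v (A *v y))"
      by (metis dot_lmul_matrix inner_commute transpose_matrix_vector)
    also have "\<dots> = 0"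
      unfolding inner_vec_def using s z by (intro sum.neutral) (auto simp: supp_def)
    finally show ?thesis using null[OF s] by simp
  qed
  then have inj: "inj G" using lin by (simp add: linear_injective_0)
  obtain B where B: "B > 0" "\<And>y. B * norm y \<le> norm (G y)"
    using linear_inj_bounded_below_pos[OF lin inj] by blast
  \<comment> \<open>This \<open>p\<close> vanishes off \<Gamma> and satisfies the normal equations
    on \<Gamma>.\<close>
  have "surj G" by (rule linear_injective_imp_surjective[OF lin inj refl])
  then obtain p where p: "G p = restrict_vec \<Gamma> (transpose A *v b)" by (metis surjD)
  have "B * norm (y - p) \<le> norm (restrict_vec \<Gamma> (transpose A *v (A *v y - b)))"
    if s: "supp y \<subseteq> \<Gamma>" for y
  proof -
    have "restrict_vec (-\<Gamma>) y = 0" using s by (auto simp: vec_eq_iff supp_def)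
    then have "G (y - p) = restrict_vec \<Gamma> (transpose A *v (A *v y - b))"
      by (simp add: linear_diff[OF lin] p matrix_vector_mult_diff_distrib)
        (simp add: G_def linear_diff[OF linear_restrict_vec])
    then show ?thesis using B(2)[of "y - p"] by simp
  qed
  with B(1) show ?thesis using that by blast
qed

text \<open>The sequences \<open>y\<close> and \<open>z\<close> are the iterates before and after
  steps that select the same \<Gamma>. Their common limit is a fixed point of the update on
  \<Gamma>, so the gradient vanishes there; off \<Gamma> the limit is zero. The limit of
  \<open>sel\<close> then compares the gradient off \<Gamma> with the entries on \<Gamma>.\<close>

lemma stable_point_of_limit:
  fixes A :: "real ^ 'N ^ 'n"
  assumes a: "\<alpha> > 0" and \<Gamma>: "\<Gamma> \<noteq> {}" "\<Gamma> \<noteq> UNIV"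
    and y: "y \<longlonglongrightarrow> p" and z: "z \<longlonglongrightarrow> p"
    and sel: "\<And>n i j. i \<in> \<Gamma> \<Longrightarrow> j \<notin> \<Gamma> \<Longrightarrow>
      \<bar>(y n - \<alpha> *\<^sub>R (transpose A *v (A *v y n - b))) $ j\<bar> \<le>
      \<bar>(y n - \<alpha> *\<^sub>R (transpose A *v (A *v y n - b))) $ i\<bar>"
    and step: "\<And>n. z n = restrict_vec \<Gamma> (y n - \<alpha> *\<^sub>R (transpose A *v (A *v y n - b)))"
  shows "stable_point_on A b \<alpha> \<Gamma> p"
proof -
  define g where "g = (\<lambda>v. transpose A *v (A *v v - b))"
  have g: "(\<lambda>n. (y n - \<alpha> *\<^sub>R g (y n)) $ i) \<longlonglongrightarrow> (p - \<alpha> *\<^sub>R g p) $ i" for i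
    unfolding g_def
    by (intro tendsto_intros y bounded_linear.tendsto[OF matrix_vector_mul_bounded_linear])
  have zi: "(\<lambda>n. z n $ i) \<longlonglongrightarrow> p $ i" for i
    by (intro tendsto_intros z)
  have off: "p $ i = 0" if "i \<notin> \<Gamma>" for i
    using zi[of i] that by (simp add: step LIMSEQ_const_iff)
  have on: "g p $ i = 0" if "i \<in> \<Gamma>" for i
  proof -
    have "(\<lambda>n. z n $ i) \<longlonglongrightarrow> (p - \<alpha> *\<^sub>R g p) $ i"
      using g[of i] that by (simp add: step g_def)
    from LIMSEQ_unique[OF this zi] show ?thesis using a by simp
  qed
  have neg: "transpose A *v (b - A *v p) = - g p"
    by (simp add: g_def matrix_vector_mult_diff_distrib)
  have cmp: "\<alpha> * \<bar>g p $ j\<bar> \<le> \<bar>p $ i\<bar>" if "i \<in> \<Gamma>" "j \<notin> \<Gamma>" for i j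
  proof -
    have "\<bar>(p - \<alpha> *\<^sub>R g p) $ j\<bar> \<le> \<bar>(p - \<alpha> *\<^sub>R g p) $ i\<bar>"
      by (rule LIMSEQ_le[OF tendsto_rabs[OF g] tendsto_rabs[OF g]])
        (use sel[OF that] in \<open>auto simp: g_def\<close>)
    then show ?thesis using off[OF that(2)] on[OF that(1)] a by (simp add: abs_mult)
  qed
  \<comment> \<open>Both extrema are attained, because \<Gamma> and its complement are nonempty, so
    the pairwise comparison suffices.\<close>
  have "Max ((\<lambda>j. \<bar>(- g p) $ j\<bar>) ` (-\<Gamma>)) \<in> (\<lambda>j. \<bar>(- g p) $ j\<bar>) ` (-\<Gamma>)"
    using \<Gamma>(2) by (intro Max_in) auto
  moreover have "Min ((\<lambda>i. \<bar>p $ i\<bar>) ` \<Gamma>) \<in> (\<lambda>i. \<bar>p $ i\<bar>) ` \<Gamma>"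
    using \<Gamma>(1) by (intro Min_in) auto
  ultimately have "\<alpha> * Max ((\<lambda>j. \<bar>(- g p) $ j\<bar>) ` (-\<Gamma>)) \<le> Min ((\<lambda>i. \<bar>p $ i\<bar>) ` \<Gamma>)"
    using cmp by auto
  then show ?thesis
    unfolding stable_point_on_def neg using on off by (auto simp: supp_def)
qed

section \<open>Convergence of the IHT iterates\<close>

theorem theorem3p6:
  fixes A :: "real ^ 'N ^ 'n" and b :: "real ^ 'n" and k :: nat and \<alpha> :: real
    and x :: "nat \<Rightarrow> real ^ 'N"
  assumes "0 < 2 * k" and "2 * k \<le> CARD('n)" and "CARD('n) \<le> CARD('N)"
    and "columns_independent (2 * k) A"
    and "\<alpha> > 0" and "\<alpha> < 1 / (1 + upper_RIP A (2 * k))"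
    and "iht_iterates A b k \<alpha> x"
  shows "\<exists>xbar. x \<longlonglongrightarrow> xbar \<and> (\<exists>\<Gamma>. card \<Gamma> = k \<and> stable_point_on A b \<alpha> \<Gamma> xbar)"
proof -
  define g where "g = (\<lambda>v. transpose A *v (A *v v - b))"
  define u where "u = (\<lambda>m. x m - \<alpha> *\<^sub>R g (x m))"
  define d where "d = (\<lambda>m. x (Suc m) - x m)"
  define c where "c = 1 - \<alpha> * (1 + upper_RIP A (2 * k))"
  \<comment> \<open>Positivity of \<alpha> forces the bound above it to be positive; only then may
    its denominator be cleared to get \<open>c > 0\<close>.\<close>
  have "0 < 1 / (1 + upper_RIP A (2 * k))" using assms(5,6) by linarith
  then have "1 + upper_RIP A (2 * k) > 0" by (simp only: zero_less_divide_1_iff)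
  then have "c > 0" using assms(6) by (simp add: c_def less_divide_eq)
  have "\<forall>m. \<exists>S. card S = k \<and> (\<forall>i\<in>S. \<forall>j\<in>-S. \<bar>u m $ j\<bar> \<le> \<bar>u m $ i\<bar>) \<and> x (Suc m) = restrict_vec S (u m)"
    using assms(7) unfolding iht_iterates_def hard_threshold_def restrict_vec_def u_def g_def by blast
  \<comment> \<open>Ties may be broken differently in each step. \<open>S m\<close> is the set kept
    in passing from \<open>x m\<close> to \<open>x (Suc m)\<close>, so it contains the support of
    the latter.\<close>
  then obtain S where S: "\<And>m. card (S m) = k"
      "\<And>m i j. i \<in> S m \<Longrightarrow> j \<notin> S m \<Longrightarrow> \<bar>u m $ j\<bar> \<le> \<bar>u m $ i\<bar>"
      "\<And>m. x (Suc m) = restrict_vec (S m) (u m)"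
    by (metis ComplI)
  have supp_S: "supp (x (Suc m)) \<subseteq> S m" for m
    by (auto simp: S(3) supp_def)
  have sparse: "norm0 (x m) \<le> k" for m
  proof (cases m)
    case 0
    then show ?thesis using assms(7) by (simp add: iht_iterates_def norm0_def supp_def)
  next
    case (Suc l)
    then show ?thesis using supp_S[of l] S(1)[of l] by (metis card_mono finite norm0_def)
  qed

  \<comment> \<open>Vanishing steps\<close>
  define F where "F = (\<lambda>m. (norm (A *v x m - b))\<^sup>2)"
  have descent: "c * (norm (d m))\<^sup>2 \<le> \<alpha> * (F m - F (Suc m))" for m
    unfolding c_def d_def F_def
  proof (rule iht_step_decrease[OF assms(5)])
    show "(norm (x (Suc m) - (x m - \<alpha> *\<^sub>R (transpose A *v (A *v x m - b)))))\<^sup>2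
      \<le> (norm (x m - (x m - \<alpha> *\<^sub>R (transpose A *v (A *v x m - b)))))\<^sup>2"
      using hard_threshold_nearest[where u = "u m" and S = "S m" and y = "x m", OF S(1) S(2) sparse]
      unfolding S(3)[of m] unfolding u_def g_def .
    show "(norm (A *v (x (Suc m) - x m)))\<^sup>2 \<le> (1 + upper_RIP A (2 * k)) * (norm (x (Suc m) - x m))\<^sup>2"
      \<comment> \<open>The difference of two \<open>k\<close>-sparse iterates is
        \<open>2 * k\<close>-sparse, which is where the order of the RIP constant comes
        from.\<close>
      using norm0_diff_le[of "x (Suc m)" "x m"] sparse[of m] sparse[of "Suc m"] assms(1)
      by (intro upper_RIP_bound) auto
  qed
  have "F (Suc m) \<le> F m" for m
  proof -
    have "0 \<le> \<alpha> * (F m - F (Suc m))"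
      using descent[of m] \<open>c > 0\<close> by (meson less_imp_le mult_nonneg_nonneg order_trans zero_le_power2)
    then show ?thesis using assms(5) by (simp add: zero_le_mult_iff)
  qed
  then have "decseq F" by (simp add: decseq_Suc_iff)
  then obtain l where l: "F \<longlonglongrightarrow> l"
    using decseq_convergent[of F 0] by (auto simp: F_def)
  have "(\<lambda>m. \<alpha> * (F m - F (Suc m)) / c) \<longlonglongrightarrow> \<alpha> * (l - l) / c"
    using \<open>c > 0\<close> by (intro tendsto_intros l LIMSEQ_Suc) auto
  then have "(\<lambda>m. \<alpha> * (F m - F (Suc m)) / c) \<longlonglongrightarrow> 0" by simp
  then have "(\<lambda>m. (norm (d m))\<^sup>2) \<longlonglongrightarrow> 0"
    by (rule tendsto_sandwich[OF _ _ tendsto_const, rotated 2])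
      (use descent \<open>c > 0\<close> in \<open>auto simp: le_divide_eq mult.commute\<close>)
  then have "(\<lambda>m. sqrt ((norm (d m))\<^sup>2)) \<longlonglongrightarrow> sqrt 0" by (rule tendsto_real_sqrt)
  then have d0: "d \<longlonglongrightarrow> 0" by (simp add: tendsto_norm_zero_iff)

  \<comment> \<open>Approach to the least squares solutions\<close>
  define e where "e = (\<lambda>m. transpose A *v (A *v d m) - (1 / \<alpha>) *\<^sub>R d m)"
  have "e \<longlonglongrightarrow> transpose A *v (A *v 0) - (1 / \<alpha>) *\<^sub>R 0"
    unfolding e_def
    by (intro tendsto_intros d0 bounded_linear.tendsto[OF matrix_vector_mul_bounded_linear])
  then have e0: "e \<longlonglongrightarrow> 0" by simp
  \<comment> \<open>On \<open>S m\<close> the step is \<open>- \<alpha>\<close> times the old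
    gradient, and the gradient changes by \<open>transpose A *v (A *v d m)\<close>; this determines
    \<open>e\<close>.\<close>
  have grad: "restrict_vec (S m) (g (x (Suc m))) = restrict_vec (S m) (e m)" for m
  proof -
    have "g (x (Suc m)) $ i = e m $ i" if "i \<in> S m" for i
    proof -
      have "d m $ i = - \<alpha> * g (x m) $ i"
        using that by (simp add: d_def S(3) u_def)
      moreover have "g (x (Suc m)) = g (x m) + transpose A *v (A *v d m)"
        by (simp add: g_def d_def matrix_vector_mult_diff_distrib)
      ultimately show ?thesis using assms(5) by (simp add: e_def)
    qed
    then show ?thesis by (auto simp: vec_eq_iff)
  qed

  have null: "y = 0" if "card \<Gamma> = k" "supp y \<subseteq> \<Gamma>" "A *v y = 0" for \<Gamma> y
  proof (rule columns_independent_null[OF assms(4) _ _ that(3)])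
    show "2 * k \<le> CARD('N)" using assms(2,3) by linarith
    show "norm0 y \<le> 2 * k"
      using that card_mono[of \<Gamma> "supp y"] by (simp add: norm0_def)
  qed
  have "\<exists>p B. B > 0 \<and>
      (\<forall>y. supp y \<subseteq> \<Gamma> \<longrightarrow> B * norm (y - p) \<le> norm (restrict_vec \<Gamma> (g y)))"
    if card: "card \<Gamma> = k" for \<Gamma>
  proof -
    show ?thesis
      unfolding g_def
      by (rule least_squares_error_bound[where A = A and b = b, OF null[OF card]], assumption+) blast
  qed
  \<comment> \<open>With the cardinality condition inside, choice yields total functions
    \<open>p\<close> and \<open>B\<close>, arbitrary on sets of other sizes.\<close>
  then have "\<forall>\<Gamma>. \<exists>p B. card \<Gamma> = k \<longrightarrow> B > 0 \<and>
      (\<forall>y. supp y \<subseteq> \<Gamma> \<longrightarrow> B * norm (y - p) \<le> norm (restrict_vec \<Gamma> (g y)))"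
    by blast
  then obtain p B where "\<forall>\<Gamma>. card \<Gamma> = k \<longrightarrow> B \<Gamma> > 0 \<and>
      (\<forall>y. supp y \<subseteq> \<Gamma> \<longrightarrow> B \<Gamma> * norm (y - p \<Gamma>) \<le> norm (restrict_vec \<Gamma> (g y)))"
    unfolding choice_iff by blast
  then have pB: "\<And>\<Gamma>. card \<Gamma> = k \<Longrightarrow> B \<Gamma> > 0"
      "\<And>\<Gamma> y. card \<Gamma> = k \<Longrightarrow> supp y \<subseteq> \<Gamma> \<Longrightarrow> B \<Gamma> * norm (y - p \<Gamma>) \<le> norm (restrict_vec \<Gamma> (g y))"
    by blast+
  have close: "eventually (\<lambda>m. dist (x (Suc m)) (p (S m)) < \<epsilon>) sequentially" if "\<epsilon> > 0" for \<epsilon>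
  proof -
    \<comment> \<open>\<open>S m\<close> varies with \<open>m\<close>, so the bound must hold for
      all \<Gamma> at once; there are only finitely many.\<close>
    have "eventually (\<lambda>m. \<forall>\<Gamma>\<in>{\<Gamma>. card \<Gamma> = k}. norm (e m) < B \<Gamma> * \<epsilon>) sequentially"
      using pB(1) that
      by (intro eventually_ball_finite) (auto intro!: order_tendstoD(2)[OF tendsto_norm_zero[OF e0]])
    then show ?thesis
    proof eventually_elim
      case (elim m)
      have "B (S m) * norm (x (Suc m) - p (S m)) \<le> norm (restrict_vec (S m) (e m))"
        using pB(2)[OF S(1) supp_S, of m] by (simp add: grad)
      also have "\<dots> < B (S m) * \<epsilon>"
        using norm_restrict_vec_le[of "S m" "e m"] elim S(1)[of m] by force
      finally show ?case using pB(1)[OF S(1), of m] by (simp add: dist_norm)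
    qed
  qed
  \<comment> \<open>The range of \<open>p\<close> is finite since there are finitely many index
    sets; its arbitrary values do no harm.\<close>
  have "\<exists>q\<in>range p. x \<longlonglongrightarrow> q"
  proof (rule convergent_if_near_finite_set)
    show "(\<lambda>m. dist (x (Suc m)) (x m)) \<longlonglongrightarrow> 0"
      using tendsto_norm_zero[OF d0] by (simp add: d_def dist_norm)
    show "eventually (\<lambda>m. \<exists>q\<in>range p. dist (x m) q < \<epsilon>) sequentially" if "\<epsilon> > 0" for \<epsilon>
    proof -
      have "eventually (\<lambda>m. \<exists>q\<in>range p. dist (x (Suc m)) q < \<epsilon>) sequentially"
        using close[OF that] by eventually_elim blast
      then show ?thesis by (rule eventually_sequentially_Suc[THEN iffD1])
    qed
  qed simp
  then obtain q where q: "x \<longlonglongrightarrow> q" by blast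

  \<comment> \<open>Stability of the limit\<close>
  have "\<exists>\<Gamma>. infinite {m. S m = \<Gamma>}"
    using pigeonhole_infinite[of UNIV S] by auto
  then obtain \<Gamma> where inf: "infinite {m. S m = \<Gamma>}" by blast
  define r where "r = enumerate {m. S m = \<Gamma>}"
  have Sr: "S (r n) = \<Gamma>" for n
    using enumerate_in_set[OF inf] by (simp add: r_def)
  have mono: "strict_mono r"
    unfolding r_def by (rule strict_mono_enumerate[OF inf])
  have card: "card \<Gamma> = k" using S(1) Sr by metis
  \<comment> \<open>Strictness on both sides makes \<open>Min\<close> over \<Gamma> and
    \<open>Max\<close> over its complement meaningful.\<close>
  have "0 < k" "k < CARD('N)" using assms(1-3) by linarith+
  have "stable_point_on A b \<alpha> \<Gamma> q"
  proof (rule stable_point_of_limit[OF assms(5)])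
    show "\<Gamma> \<noteq> {}" "\<Gamma> \<noteq> UNIV" using card \<open>0 < k\<close> \<open>k < CARD('N)\<close> by auto
    show "(\<lambda>n. x (r n)) \<longlonglongrightarrow> q"
      using LIMSEQ_subseq_LIMSEQ[OF q mono] by (simp add: o_def)
    show "(\<lambda>n. x (Suc (r n))) \<longlonglongrightarrow> q"
      using LIMSEQ_subseq_LIMSEQ[OF LIMSEQ_Suc[OF q] mono] by (simp add: o_def)
    show "\<bar>(x (r n) - \<alpha> *\<^sub>R (transpose A *v (A *v x (r n) - b))) $ j\<bar> \<le>
        \<bar>(x (r n) - \<alpha> *\<^sub>R (transpose A *v (A *v x (r n) - b))) $ i\<bar>"
      if "i \<in> \<Gamma>" "j \<notin> \<Gamma>" for n i j
      using S(2)[where m = "r n", unfolded Sr, OF that] unfolding u_def g_def .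
    show "x (Suc (r n)) = restrict_vec \<Gamma> (x (r n) - \<alpha> *\<^sub>R (transpose A *v (A *v x (r n) - b)))" for n
      using S(3)[of "r n"] unfolding Sr u_def g_def .
  qed
  then show ?thesis using q card by blast
qed

end
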